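(* Let $n \geq 2$, let $\Omega \subset \mathbb{R}^n$ be open, and let $s\in(0,1)$ with $s > \frac{n-1}{n}$. Let $f \in C^s(\Omega;\mathbb{R}^n)$ be the pointwise limit of a sequence of homeomorphisms (onto their images) $f_j \in C^{s}(\Omega;\mathbb{R}^n)$ that is equibounded in $C^s$, i.e. $\sup_j \|f_j\|_{C^s(\Omega)}<\infty$. Then there is a set $\Gamma \subset \mathbb{R}^n$ of Hausdorff dimension at most $\frac{n-1}{s}$ such that $f^{-1}(\{y\})$ consists of only one point for every $y \in f(\Omega) \setminus \Gamma$.
   Context: $C^s(\Omega;\mathbb{R}^n)$ is the space of Hölder continuous maps of exponent $s$, with norm $\|u\|_{C^s(\Omega)} := \sup_{x\in\Omega}|u(x)| + \sup_{x\neq y\in\Omega}\frac{|u(x)-u(y)|}{|x-y|^s}$. *)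

theory Defs
  imports "HOL-Analysis.Analysis"
begin

text \<open>The Hoelder norm takes values in \<^typ>\<open>ennreal\<close>, so it is \<open>\<infinity>\<close> exactly when \<open>u\<close> is
  not in the space \<open>C\<^sup>s\<close>. Maps are total functions of which only the values on \<open>\<Omega>\<close> matter.\<close>

definition holder_norm ::
    "real \<Rightarrow> 'a::real_normed_vector set \<Rightarrow> ('a \<Rightarrow> 'b::real_normed_vector) \<Rightarrow> ennreal" where
  "holder_norm s \<Omega> u =
     (SUP x\<in>\<Omega>. ennreal (norm (u x))) +
     (SUP x\<in>\<Omega>. SUP y\<in>\<Omega> - {x}. ennreal (norm (u x - u y) / norm (x - y) powr s))"

definition holder_space ::
    "real \<Rightarrow> 'a::real_normed_vector set \<Rightarrow> ('a \<Rightarrow> 'b::real_normed_vector) set" where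
  "holder_space s \<Omega> = {u. holder_norm s \<Omega> u < \<infinity>}"

text \<open>The contribution \<open>(diam U)\<^sup>d\<close> of a covering set, with the conventions \<open>0\<^sup>0 = 1\<close> for nonempty
  \<open>U\<close> (whereas \<open>0 powr 0 = 0\<close>) and \<open>0\<close> for empty \<open>U\<close>. Thus the 0-dimensional measure counts points.\<close>

definition diameter_pow :: "real \<Rightarrow> 'a::metric_space set \<Rightarrow> ennreal" where
  "diameter_pow d U =
     (if U = {} then 0 else if d = 0 then 1 else ennreal (diameter U powr d))"

text \<open>Boundedness is required explicitly because \<^const>\<open>diameter\<close> is unspecified on unbounded sets.\<close>

definition hausdorff_premeasure ::
    "real \<Rightarrow> real \<Rightarrow> 'a::metric_space set \<Rightarrow> ennreal" where
  "hausdorff_premeasure d \<delta> A =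
     (INF U\<in>{U :: nat \<Rightarrow> 'a set.
               A \<subseteq> (\<Union>i. U i) \<and> (\<forall>i. bounded (U i) \<and> diameter (U i) \<le> \<delta>)}.
        \<Sum>i. diameter_pow d (U i))"

text \<open>The \<open>d\<close>-dimensional Hausdorff outer measure for \<open>d \<ge> 0\<close>, without a dimensional normalising
  constant, which does not affect the Hausdorff dimension.\<close>

definition hausdorff_measure :: "real \<Rightarrow> 'a::metric_space set \<Rightarrow> ennreal" where
  "hausdorff_measure d A = (SUP \<delta>\<in>{0<..}. hausdorff_premeasure d \<delta> A)"

definition hausdorff_dim :: "'a::metric_space set \<Rightarrow> ennreal" where
  "hausdorff_dim A = Inf {ennreal d | d. d \<ge> 0 \<and> hausdorff_measure d A = 0}"

end

theory Submission
  imports Defs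
begin

text \<open>Take for \<open>\<Gamma>\<close> the image under \<open>f\<close> of all points of \<open>\<Omega>\<close> with at least one rational
  coordinate. These points lie on countably many hyperplanes. A bounded piece of a hyperplane in
  dimension \<open>n\<close> is covered by \<open>O(m\<^bsup>n-1\<^esup>)\<close> cubes of side \<open>1/m\<close>, whose images under an
  \<open>s\<close>-Hoelder map have diameter \<open>O(m\<^bsup>-s\<^esup>)\<close>. So the \<open>d\<close>-dimensional measure of the image
  vanishes as soon as \<open>s d > n - 1\<close>, which gives the bound on the dimension of \<open>\<Gamma>\<close>
  (\<open>hausdorff_dim_holder_image_rational_grid\<close>).

  Off \<open>\<Gamma>\<close>, uniqueness of the preimage comes from invariance of domain, without degree theory. Let
  \<open>f x\<^sub>1 = f x\<^sub>2 = y\<close> with \<open>x\<^sub>1 \<noteq> x\<^sub>2\<close>, and surround the two points by boxes \<open>U\<^sub>1\<close>, \<open>U\<^sub>2\<close> with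
  rational corners and disjoint closures in \<open>\<Omega>\<close>. The boundaries of the boxes consist of points
  with a rational coordinate, so \<open>f\<close> does not take the value \<open>y\<close> there. By equicontinuity and
  compactness some ball around \<open>y\<close> is avoided by \<open>F j\<close> on these boundaries for all large \<open>j\<close>.
  The set \<open>F j ` U\<^sub>i\<close> is open with boundary in the image of the boundary of \<open>U\<^sub>i\<close>, and
  it contains \<open>F j x\<^sub>i\<close>, which is close to \<open>y\<close>; as the ball is connected, it lies in \<open>F j ` U\<^sub>i\<close>
  (\<open>limit_value_eventually_attained\<close>). Thus \<open>F j\<close> attains \<open>y\<close> in both boxes, contradicting
  injectivity.\<close>

section \<open>Hausdorff null sets\<close>

lemma hausdorff_premeasure_finite_cover:
  fixes U :: "'i \<Rightarrow> 'a::metric_space set"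
  assumes "finite I" and cov: "A \<subseteq> (\<Union>i\<in>I. U i)" and "0 < \<delta>"
    and U: "\<And>i. i \<in> I \<Longrightarrow> bounded (U i) \<and> diameter (U i) \<le> \<delta>"
  shows "hausdorff_premeasure d \<delta> A \<le> (\<Sum>i\<in>I. diameter_pow d (U i))"
proof -
  obtain h where h: "bij_betw h {..<card I} I"
    using ex_bij_betw_nat_finite[OF \<open>finite I\<close>] by (auto simp: atLeast0LessThan)
  \<comment> \<open>The empty set contributes nothing, even for \<open>d = 0\<close>, so it can fill up the sequence.\<close>
  define V where "V k = (if k < card I then U (h k) else {})" for k
  have "A \<subseteq> (\<Union>k. V k)"
  proof
    fix x assume "x \<in> A"
    then obtain i where i: "i \<in> I" "x \<in> U i" using cov by blast
    then obtain k where "k < card I" "h k = i"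
      using h by (metis bij_betw_imp_surj_on imageE lessThan_iff)
    then have "x \<in> V k" using i by (simp add: V_def)
    then show "x \<in> (\<Union>k. V k)" by blast
  qed
  moreover have "bounded (V k) \<and> diameter (V k) \<le> \<delta>" for k
    using U[of "h k"] h \<open>0 < \<delta>\<close> by (auto simp: V_def bij_betw_def)
  ultimately have "hausdorff_premeasure d \<delta> A \<le> (\<Sum>k. diameter_pow d (V k))"
    unfolding hausdorff_premeasure_def by (intro INF_lower) blast
  also have "\<dots> = (\<Sum>k<card I. diameter_pow d (V k))"
    by (intro suminf_finite) (auto simp: V_def diameter_pow_def)
  also have "\<dots> = (\<Sum>k<card I. diameter_pow d (U (h k)))"
    by (intro sum.cong) (auto simp: V_def)
  also have "\<dots> = (\<Sum>i\<in>I. diameter_pow d (U i))"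
    by (rule sum.reindex_bij_betw[OF h])
  finally show ?thesis .
qed

lemma hausdorff_measure_eq_0I:
  assumes "\<And>\<delta> \<epsilon>. 0 < \<delta> \<Longrightarrow> 0 < \<epsilon> \<Longrightarrow> hausdorff_premeasure d \<delta> A \<le> ennreal \<epsilon>"
  shows "hausdorff_measure d A = 0"
proof -
  have "hausdorff_premeasure d \<delta> A \<le> 0" if "0 < \<delta>" for \<delta>
  proof (rule ennreal_le_epsilon)
    fix e :: real assume "0 < e"
    then show "hausdorff_premeasure d \<delta> A \<le> 0 + ennreal e"
      using assms[OF that, of e] by simp
  qed
  then have "hausdorff_measure d A \<le> 0"
    unfolding hausdorff_measure_def by (intro SUP_least) auto
  then show ?thesis by simp
qed

text \<open>The \<open>i\<close>-th set is covered at cost below \<open>\<epsilon> / 2\<^bsup>i+1\<^esup>\<close>, and the covers are merged into one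
  sequence by the pairing function on the naturals.\<close>

lemma hausdorff_measure_UN_null_nat:
  fixes A :: "nat \<Rightarrow> 'a::metric_space set"
  assumes "\<And>i. hausdorff_measure d (A i) = 0"
  shows "hausdorff_measure d (\<Union>i. A i) = 0"
proof (rule hausdorff_measure_eq_0I)
  fix \<delta> \<epsilon> :: real assume "0 < \<delta>" "0 < \<epsilon>"
  define c where "c i = \<epsilon> * (1/2) ^ Suc i" for i
  have "\<exists>U :: nat \<Rightarrow> 'a set. (A i \<subseteq> (\<Union>k. U k) \<and> (\<forall>k. bounded (U k) \<and> diameter (U k) \<le> \<delta>))
      \<and> (\<Sum>k. diameter_pow d (U k)) < ennreal (c i)" for i
  proof -
    have "hausdorff_premeasure d \<delta> (A i) \<le> hausdorff_measure d (A i)"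
      unfolding hausdorff_measure_def using \<open>0 < \<delta>\<close> by (intro SUP_upper) simp
    also have "\<dots> < ennreal (c i)"
      using assms \<open>0 < \<epsilon>\<close> by (simp add: c_def)
    finally show ?thesis
      unfolding hausdorff_premeasure_def INF_less_iff by blast
  qed
  then obtain U :: "nat \<Rightarrow> nat \<Rightarrow> 'a set"
    where U: "\<And>i. A i \<subseteq> (\<Union>k. U i k)" "\<And>i k. bounded (U i k)" "\<And>i k. diameter (U i k) \<le> \<delta>"
      and less: "\<And>i. (\<Sum>k. diameter_pow d (U i k)) < ennreal (c i)"
    by metis
  define V where "V = case_prod U \<circ> prod_decode"
  have "(\<Union>i. A i) \<subseteq> (\<Union>k. V k)"
  proof
    fix x assume "x \<in> (\<Union>i. A i)"
    then obtain i k where "x \<in> U i k" using U(1) by blast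
    then have "x \<in> V (prod_encode (i, k))" by (simp add: V_def)
    then show "x \<in> (\<Union>k. V k)" by blast
  qed
  moreover have "bounded (V k) \<and> diameter (V k) \<le> \<delta>" for k
    using U(2,3) by (simp add: V_def split: prod.split)
  ultimately have "hausdorff_premeasure d \<delta> (\<Union>i. A i) \<le> (\<Sum>k. diameter_pow d (V k))"
    unfolding hausdorff_premeasure_def by (intro INF_lower) blast
  also have "\<dots> = (\<Sum>k. (\<lambda>(i, k). diameter_pow d (U i k)) (prod_decode k))"
    by (simp add: V_def case_prod_unfold)
  also have "\<dots> = (\<Sum>i. \<Sum>k. diameter_pow d (U i k))"
    using suminf_ennreal_2dimen[of "\<lambda>i. \<Sum>k. diameter_pow d (U i k)"
        "\<lambda>(i, k). diameter_pow d (U i k)"]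
    by (simp add: comp_def)
  also have "\<dots> \<le> (\<Sum>i. ennreal (c i))"
    using less by (intro suminf_le) (auto intro: less_imp_le)
  also have "\<dots> = ennreal \<epsilon>"
  proof (rule suminf_ennreal_eq)
    show "c sums \<epsilon>"
      using sums_mult[OF power_half_series, of \<epsilon>] by (simp add: c_def[abs_def])
  qed (use \<open>0 < \<epsilon>\<close> in \<open>simp add: c_def\<close>)
  finally show "hausdorff_premeasure d \<delta> (\<Union>i. A i) \<le> ennreal \<epsilon>" .
qed

lemma hausdorff_measure_UN_null:
  assumes "countable I" and null: "\<And>i. i \<in> I \<Longrightarrow> hausdorff_measure d (A i) = 0"
  shows "hausdorff_measure d (\<Union>i\<in>I. A i) = 0"
proof (cases "I = {}")
  case True
  show ?thesis
  proof (rule hausdorff_measure_eq_0I)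
    fix \<delta> \<epsilon> :: real assume "0 < \<delta>" "0 < \<epsilon>"
    then show "hausdorff_premeasure d \<delta> (\<Union>i\<in>I. A i) \<le> ennreal \<epsilon>"
      using hausdorff_premeasure_finite_cover[of "{}::nat set" "\<Union>i\<in>I. A i" "\<lambda>_. {}" \<delta> d] True by simp
  qed
next
  case False
  have "(\<Union>i\<in>I. A i) = (\<Union>i\<in>range (from_nat_into I). A i)"
    by (subst range_from_nat_into[OF False \<open>countable I\<close>]) (rule refl)
  also have "\<dots> = (\<Union>k. A (from_nat_into I k))"
    by blast
  finally have "(\<Union>i\<in>I. A i) = (\<Union>k. A (from_nat_into I k))" .
  moreover have "hausdorff_measure d (\<Union>k. A (from_nat_into I k)) = 0"
    by (intro hausdorff_measure_UN_null_nat null from_nat_into False)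
  ultimately show ?thesis by simp
qed

lemma hausdorff_dim_leI:
  assumes "0 \<le> D" and "\<And>d. D < d \<Longrightarrow> hausdorff_measure d A = 0"
  shows "hausdorff_dim A \<le> ennreal D"
proof (rule ennreal_le_epsilon)
  fix e :: real assume "0 < e"
  then have "ennreal (D + e) \<in> {ennreal d | d. d \<ge> 0 \<and> hausdorff_measure d A = 0}"
    using assms by (intro CollectI exI[of _ "D + e"]) auto
  then have "hausdorff_dim A \<le> ennreal (D + e)"
    unfolding hausdorff_dim_def by (rule Inf_lower)
  then show "hausdorff_dim A \<le> ennreal D + ennreal e"
    using \<open>0 \<le> D\<close> \<open>0 < e\<close> by simp
qed

section \<open>Hoelder images of hyperplanes\<close>

lemma holder_norm_bound:
  assumes "holder_norm s \<Omega> u \<le> ennreal M" "0 \<le> M" "x \<in> \<Omega>" "y \<in> \<Omega>"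
  shows "norm (u x - u y) \<le> M * norm (x - y) powr s"
proof (cases "x = y")
  case False
  have "ennreal (norm (u x - u y) / norm (x - y) powr s)
      \<le> (SUP y\<in>\<Omega> - {x}. ennreal (norm (u x - u y) / norm (x - y) powr s))"
    using assms False by (intro SUP_upper) auto
  also have "\<dots> \<le> (SUP x\<in>\<Omega>. SUP y\<in>\<Omega> - {x}. ennreal (norm (u x - u y) / norm (x - y) powr s))"
    using assms by (intro SUP_upper) auto
  also have "\<dots> \<le> holder_norm s \<Omega> u"
    unfolding holder_norm_def by simp
  also have "\<dots> \<le> ennreal M" by fact
  finally have "norm (u x - u y) / norm (x - y) powr s \<le> M"
    using \<open>0 \<le> M\<close> by simp
  then show ?thesis
    using False by (simp add: divide_le_eq)
qed simp

text \<open>Index the half-open cubes of side \<open>1/m\<close> by the integer vectors \<open>\<lfloor>m x\<rfloor>\<close>. On the hyperplane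
  the \<open>i\<close>-th entry of this vector is fixed, and each of the others lies between \<open>- N m\<close> and \<open>N m\<close>,
  which leaves \<open>2 N m + 1 \<le> 3 N m\<close> values.\<close>

lemma hyperplane_grid_cover:
  fixes i :: "'a::euclidean_space"
  assumes i: "i \<in> Basis" and "1 \<le> N" "1 \<le> m"
  obtains I :: "('a \<Rightarrow> int) set" and Q :: "('a \<Rightarrow> int) \<Rightarrow> 'a set"
  where "finite I" "card I \<le> (3 * N * m) ^ (DIM('a) - 1)"
    "{x. x \<bullet> i = q \<and> (\<forall>j\<in>Basis. \<bar>x \<bullet> j\<bar> \<le> real N)} \<subseteq> (\<Union>k\<in>I. Q k)"
    "\<And>k x y. x \<in> Q k \<Longrightarrow> y \<in> Q k \<Longrightarrow> norm (x - y) \<le> real DIM('a) / real m"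
proof
  define J where "J j = (if j = i then {\<lfloor>real m * q\<rfloor>} else {- int (N * m)..int (N * m)})" for j :: 'a
  define I where "I = PiE Basis J"
  define Q where "Q k = {x::'a. \<forall>j\<in>Basis. \<lfloor>real m * (x \<bullet> j)\<rfloor> = k j}" for k
  show "finite I"
    unfolding I_def by (intro finite_PiE) (auto simp: J_def)
  have "card I = (\<Prod>j\<in>Basis. card (J j))"
    unfolding I_def by (rule card_PiE) simp
  also have "\<dots> = (\<Prod>j\<in>Basis - {i}. 2 * N * m + 1)"
    using i by (subst prod.remove[of _ i]) (auto simp: J_def nat_add_distrib nat_mult_distrib mult.assoc)
  also have "\<dots> = (2 * N * m + 1) ^ (DIM('a) - 1)"
    using i by simp
  also have "\<dots> \<le> (3 * N * m) ^ (DIM('a) - 1)"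
    using mult_le_mono[OF \<open>1 \<le> N\<close> \<open>1 \<le> m\<close>] by (intro power_mono) auto
  finally show "card I \<le> (3 * N * m) ^ (DIM('a) - 1)" .
  show "{x. x \<bullet> i = q \<and> (\<forall>j\<in>Basis. \<bar>x \<bullet> j\<bar> \<le> real N)} \<subseteq> (\<Union>k\<in>I. Q k)"
  proof
    fix x assume x: "x \<in> {x. x \<bullet> i = q \<and> (\<forall>j\<in>Basis. \<bar>x \<bullet> j\<bar> \<le> real N)}"
    define k where "k = restrict (\<lambda>j. \<lfloor>real m * (x \<bullet> j)\<rfloor>) Basis"
    have "k j \<in> J j" if j: "j \<in> Basis" for j
    proof (cases "j = i")
      case False
      have "\<bar>real m * (x \<bullet> j)\<bar> \<le> real m * real N"
        using x j by (simp add: abs_mult mult_left_mono)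
      then have "- real_of_int (int (N * m)) \<le> real m * (x \<bullet> j)"
          "real m * (x \<bullet> j) \<le> real_of_int (int (N * m))"
        by (simp_all add: abs_le_iff mult.commute)
      then have "- int (N * m) \<le> \<lfloor>real m * (x \<bullet> j)\<rfloor>" "\<lfloor>real m * (x \<bullet> j)\<rfloor> \<le> int (N * m)"
        by linarith+
      then show ?thesis
        using False j by (simp add: J_def k_def)
    qed (use x j in \<open>simp add: J_def k_def\<close>)
    then have "k \<in> I"
      by (auto simp: I_def k_def)
    moreover have "x \<in> Q k"
      by (simp add: Q_def k_def)
    ultimately show "x \<in> (\<Union>k\<in>I. Q k)" by blast
  qed
  show "norm (x - y) \<le> real DIM('a) / real m" if x: "x \<in> Q k" and y: "y \<in> Q k" for k x y
  proof -
    have "\<bar>(x - y) \<bullet> j\<bar> \<le> 1 / real m" if "j \<in> Basis" for j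
    proof -
      have "\<lfloor>real m * (x \<bullet> j)\<rfloor> = \<lfloor>real m * (y \<bullet> j)\<rfloor>"
        using x y that by (simp add: Q_def)
      then have "\<bar>real m * (x \<bullet> j) - real m * (y \<bullet> j)\<bar> \<le> 1"
        by linarith
      also have "real m * (x \<bullet> j) - real m * (y \<bullet> j) = real m * ((x - y) \<bullet> j)"
        by (simp add: inner_diff_left algebra_simps)
      finally show ?thesis
        using \<open>1 \<le> m\<close> by (simp add: abs_mult field_simps)
    qed
    then have "(\<Sum>j\<in>Basis. \<bar>(x - y) \<bullet> j\<bar>) \<le> real DIM('a) * (1 / real m)"
      by (rule sum_bounded_above)
    then show ?thesis
      using norm_le_l1[of "x - y"] by simp
  qed
qed

text \<open>With \<open>n = DIM('a)\<close>, mapping the grid cover of mesh \<open>1/m\<close> forward costs at most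
  \<open>(3 N m)\<^bsup>n-1\<^esup> (M (n/m)\<^bsup>s\<^esup>)\<^bsup>d\<^esup>\<close>, a constant times \<open>m\<^bsup>n-1-sd\<^esup>\<close>, which tends to \<open>0\<close>.\<close>

lemma hausdorff_measure_holder_image_hyperplane_piece:
  fixes f :: "'a::euclidean_space \<Rightarrow> 'b::real_normed_vector"
  assumes i: "i \<in> Basis" and "1 \<le> N" and "0 < s" and d: "(real DIM('a) - 1) / s < d"
    and S: "S \<subseteq> {x. x \<bullet> i = q \<and> (\<forall>j\<in>Basis. \<bar>x \<bullet> j\<bar> \<le> real N)}"
    and "0 \<le> M" and f: "\<And>x y. x \<in> S \<Longrightarrow> y \<in> S \<Longrightarrow> norm (f x - f y) \<le> M * norm (x - y) powr s"
  shows "hausdorff_measure d (f ` S) = 0"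
proof (rule hausdorff_measure_eq_0I)
  fix \<delta> \<epsilon> :: real assume "0 < \<delta>" "0 < \<epsilon>"
  define n where "n = DIM('a)"
  have "1 \<le> n" by (simp add: n_def)
  have exponent: "real (n - 1) < s * d"
    using d \<open>0 < s\<close> \<open>1 \<le> n\<close> by (simp add: n_def field_simps of_nat_diff)
  then have "0 < d"
    using \<open>0 < s\<close> by (metis of_nat_0_le_iff order_le_less_trans zero_less_mult_pos)
  \<comment> \<open>\<open>r m\<close> bounds the diameter of the image of a cell, and \<open>T m\<close> the total cost of the cover.\<close>
  define r where "r m = M * (real n / real m) powr s" for m
  have r_nonneg: "0 \<le> r m" for m
    using \<open>0 \<le> M\<close> by (simp add: r_def)
  have n_over_m: "(\<lambda>m. real n / real m) \<longlonglongrightarrow> 0"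
    by (rule lim_const_over_n)
  have "((\<lambda>m. r m) \<longlonglongrightarrow> M * 0 powr s)"
    unfolding r_def using \<open>0 < s\<close> by (intro tendsto_intros tendsto_powr2 n_over_m) auto
  then have ev_r: "\<forall>\<^sub>F m in sequentially. r m < \<delta>"
    using \<open>0 < \<delta>\<close> by (intro order_tendstoD(2)) auto
  define T where "T m = real ((3 * N * m) ^ (n - 1)) * r m powr d" for m
  define C where "C = real (3 * N) ^ (n - 1) * (M * real n powr s) powr d"
  have T_eq: "T m = C * real m powr (real (n - 1) - s * d)" if "1 \<le> m" for m
  proof -
    have "r m = M * real n powr s * real m powr (- s)"
      by (simp add: r_def powr_divide powr_minus_divide)
    then have "r m powr d = (M * real n powr s) powr d * real m powr (- s * d)"
      using \<open>0 \<le> M\<close> by (simp add: powr_mult powr_powr)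
    moreover have "real ((3 * N * m) ^ (n - 1)) = real (3 * N) ^ (n - 1) * real m powr real (n - 1)"
      using that by (simp add: power_mult_distrib powr_realpow)
    ultimately show ?thesis
      by (simp add: T_def C_def powr_diff powr_minus_divide)
  qed
  have "(\<lambda>m. C * real m powr (real (n - 1) - s * d)) \<longlonglongrightarrow> C * 0"
    using exponent by (intro tendsto_intros tendsto_neg_powr filterlim_real_sequentially) auto
  then have "\<forall>\<^sub>F m in sequentially. C * real m powr (real (n - 1) - s * d) < \<epsilon>"
    using \<open>0 < \<epsilon>\<close> by (intro order_tendstoD(2)) auto
  then have "\<forall>\<^sub>F m in sequentially. r m < \<delta> \<and> C * real m powr (real (n - 1) - s * d) < \<epsilon> \<and> 1 \<le> m"
    using ev_r eventually_ge_at_top[of 1] by eventually_elim simp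
  then obtain m where m: "1 \<le> m" "r m \<le> \<delta>" "T m \<le> \<epsilon>"
    using T_eq by (metis (no_types, lifting) eventually_sequentially less_imp_le order_refl)
  obtain I :: "('a \<Rightarrow> int) set" and Q :: "('a \<Rightarrow> int) \<Rightarrow> 'a set"
    where I: "finite I" "card I \<le> (3 * N * m) ^ (n - 1)"
    and cover: "{x. x \<bullet> i = q \<and> (\<forall>j\<in>Basis. \<bar>x \<bullet> j\<bar> \<le> real N)} \<subseteq> (\<Union>k\<in>I. Q k)"
    and Q: "\<And>k x y. x \<in> Q k \<Longrightarrow> y \<in> Q k \<Longrightarrow> norm (x - y) \<le> real n / real m"
    by (rule hyperplane_grid_cover[OF i \<open>1 \<le> N\<close> m(1), of q, folded n_def]) (rule that)
  \<comment> \<open>Cells may leave \<open>S\<close>, where \<open>f\<close> is not controlled, so only their traces on \<open>S\<close> are mapped.\<close>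
  define U where "U k = f ` (S \<inter> Q k)" for k
  have dist_U: "dist u v \<le> r m" if uv: "u \<in> U k" "v \<in> U k" for u v k
  proof -
    obtain x y where xy: "x \<in> S \<inter> Q k" "y \<in> S \<inter> Q k" "u = f x" "v = f y"
      using uv unfolding U_def by blast
    then have "dist u v \<le> M * norm (x - y) powr s"
      using f by (simp add: dist_norm)
    also have "\<dots> \<le> r m"
      unfolding r_def using xy Q[of x k y] \<open>0 \<le> M\<close> \<open>0 < s\<close>
      by (intro mult_left_mono powr_mono2) auto
    finally show ?thesis .
  qed
  have bdd_U: "bounded (U k)" for k
  proof (cases "U k = {}")
    case False
    then obtain u where "u \<in> U k" by blast
    then show ?thesis
      unfolding bounded_def using dist_U by blast
  qed simp
  have diam_U: "diameter (U k) \<le> r m" for k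
    using dist_U r_nonneg by (intro diameter_le) (auto simp: dist_norm)
  have "hausdorff_premeasure d \<delta> (f ` S) \<le> (\<Sum>k\<in>I. diameter_pow d (U k))"
  proof (rule hausdorff_premeasure_finite_cover[OF I(1)])
    show "f ` S \<subseteq> (\<Union>k\<in>I. U k)"
      using S cover by (fastforce simp: U_def)
  qed (use \<open>0 < \<delta>\<close> bdd_U diam_U m(2) in \<open>auto intro: order_trans\<close>)
  also have "\<dots> \<le> (\<Sum>k\<in>I. ennreal (r m powr d))"
    using diam_U diameter_ge_0[OF bdd_U] \<open>0 < d\<close>
    by (intro sum_mono) (auto simp: diameter_pow_def intro!: ennreal_leI powr_mono2)
  also have "\<dots> = ennreal (real (card I) * r m powr d)"
    by (simp add: ennreal_mult ennreal_of_nat_eq_real_of_nat)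
  also have "\<dots> \<le> ennreal (T m)"
    unfolding T_def by (intro ennreal_leI mult_right_mono of_nat_mono I(2)) simp
  also have "\<dots> \<le> ennreal \<epsilon>"
    using m(3) by (rule ennreal_leI)
  finally show "hausdorff_premeasure d \<delta> (f ` S) \<le> ennreal \<epsilon>" .
qed

text \<open>A countable union of hyperplanes that contains the boundaries of arbitrarily small boxes around
  every point.\<close>

definition rational_grid :: "'a::euclidean_space set" where
  "rational_grid = {x. \<exists>i\<in>Basis. x \<bullet> i \<in> \<rat>}"

text \<open>Cut into countably many bounded pieces of hyperplanes, indexed by the normal direction \<open>i\<close>, the
  rational height \<open>q\<close> and the size \<open>N\<close> of the piece.\<close>

lemma hausdorff_dim_holder_image_rational_grid:
  fixes f :: "'a::euclidean_space \<Rightarrow> 'b::real_normed_vector"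
  assumes "0 < s" and "0 \<le> M"
    and f: "\<And>x y. x \<in> \<Omega> \<Longrightarrow> y \<in> \<Omega> \<Longrightarrow> norm (f x - f y) \<le> M * norm (x - y) powr s"
  shows "hausdorff_dim (f ` (\<Omega> \<inter> rational_grid)) \<le> ennreal ((real DIM('a) - 1) / s)"
proof (rule hausdorff_dim_leI)
  have "1 \<le> real DIM('a)" by (simp add: Suc_le_eq)
  then show "0 \<le> (real DIM('a) - 1) / s" using \<open>0 < s\<close> by simp
next
  fix d assume d: "(real DIM('a) - 1) / s < d"
  define P where "P = (\<lambda>(i, q, N). \<Omega> \<inter> {x::'a. x \<bullet> i = q \<and> (\<forall>j\<in>Basis. \<bar>x \<bullet> j\<bar> \<le> real N)})"
  define I where "I = (Basis :: 'a set) \<times> (\<rat> :: real set) \<times> {1::nat..}"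
  have "\<Omega> \<inter> rational_grid = (\<Union>p\<in>I. P p)"
  proof
    show "\<Omega> \<inter> rational_grid \<subseteq> (\<Union>p\<in>I. P p)"
    proof
      fix x assume x: "x \<in> \<Omega> \<inter> rational_grid"
      then obtain i where i: "i \<in> Basis" "x \<bullet> i \<in> \<rat>"
        by (auto simp: rational_grid_def)
      have "\<bar>x \<bullet> j\<bar> \<le> real (Suc (nat \<lceil>norm x\<rceil>))" if "j \<in> Basis" for j
        using Basis_le_norm[OF that, of x] real_nat_ceiling_ge[of "norm x"] unfolding of_nat_Suc by linarith
      then have "x \<in> P (i, x \<bullet> i, Suc (nat \<lceil>norm x\<rceil>))"
        using x by (simp add: P_def)
      moreover have "(i, x \<bullet> i, Suc (nat \<lceil>norm x\<rceil>)) \<in> I"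
        using i by (simp add: I_def)
      ultimately show "x \<in> (\<Union>p\<in>I. P p)" by blast
    qed
  qed (auto simp: P_def I_def rational_grid_def)
  then have "f ` (\<Omega> \<inter> rational_grid) = (\<Union>p\<in>I. f ` P p)"
    by (simp add: image_UN)
  moreover have "hausdorff_measure d (\<Union>p\<in>I. f ` P p) = 0"
  proof (rule hausdorff_measure_UN_null)
    show "countable I"
      unfolding I_def by (intro countable_SIGMA) (auto simp: countable_rat countable_finite)
    fix p assume "p \<in> I"
    then obtain i q N where "p = (i, q, N)" "i \<in> Basis" "1 \<le> N"
      by (auto simp: I_def)
    then show "hausdorff_measure d (f ` P p) = 0"
      using assms
      by (intro hausdorff_measure_holder_image_hyperplane_piece[OF _ _ _ d, of i N _ q M])
        (auto simp: P_def)
  qed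
  ultimately show "hausdorff_measure d (f ` (\<Omega> \<inter> rational_grid)) = 0" by simp
qed

lemma frontier_rational_box_subset_grid:
  fixes a b :: "'a::euclidean_space"
  assumes "\<And>i. i \<in> Basis \<Longrightarrow> a \<bullet> i \<in> \<rat>" "\<And>i. i \<in> Basis \<Longrightarrow> b \<bullet> i \<in> \<rat>"
  shows "frontier (box a b) \<subseteq> rational_grid"
proof
  fix x assume "x \<in> frontier (box a b)"
  then have x: "x \<in> cbox a b" "x \<notin> box a b"
    using closure_mono[OF box_subset_cbox, of a b]
    by (auto simp: frontier_def interior_open open_box closure_closed)
  then obtain i where "i \<in> Basis" "x \<bullet> i = a \<bullet> i \<or> x \<bullet> i = b \<bullet> i"
    by (force simp: mem_box)
  then show "x \<in> rational_grid"
    unfolding rational_grid_def mem_Collect_eq using assms by metis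
qed

section \<open>Values of limits of injective maps\<close>

text \<open>This replaces the usual degree argument. By invariance of domain \<open>g ` U\<close> is open, and by
  compactness of \<open>closure U\<close> its boundary is contained in \<open>g ` frontier U\<close>. A connected set that
  meets \<open>g ` U\<close> can only leave it through this boundary.\<close>

lemma injective_image_contains_connected:
  fixes g :: "'a::euclidean_space \<Rightarrow> 'a"
  assumes "open U" "bounded U" and cont: "continuous_on (closure U) g" and inj: "inj_on g U"
    and "connected C" and meets: "C \<inter> g ` U \<noteq> {}" and avoids: "C \<inter> g ` frontier U = {}"
  shows "C \<subseteq> g ` U"
proof -
  have contU: "continuous_on U g"
    using cont closure_subset by (rule continuous_on_subset)
  have op: "open (g ` U)"
    using invariance_of_domain[OF contU \<open>open U\<close> inj] .
  have "compact (g ` closure U)"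
    using \<open>bounded U\<close> by (intro compact_continuous_image[OF cont]) simp
  then have "closure (g ` U) \<subseteq> g ` closure U"
    by (intro closure_minimal image_mono closure_subset compact_imp_closed)
  then have "frontier (g ` U) \<subseteq> g ` frontier U"
    using op \<open>open U\<close> by (auto simp: frontier_def interior_open)
  then show ?thesis
    using connected_Int_frontier[OF \<open>connected C\<close> meets] avoids by blast
qed

text \<open>Pointwise convergence controls \<open>F j\<close> at the centres of a finite cover of \<open>K\<close>, and equicontinuity
  carries the control over to all of \<open>K\<close>.\<close>

lemma eventually_uniformly_away_from_value:
  fixes F :: "nat \<Rightarrow> 'a::metric_space \<Rightarrow> 'b::metric_space"
  assumes "compact K" and lim: "\<And>z. z \<in> K \<Longrightarrow> (\<lambda>j. F j z) \<longlonglongrightarrow> f z"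
    and equi: "\<And>z e. z \<in> K \<Longrightarrow> 0 < e \<Longrightarrow>
      \<exists>r>0. \<forall>j. \<forall>w\<in>K. dist w z < r \<longrightarrow> dist (F j w) (F j z) < e"
    and y: "y \<notin> f ` K"
  obtains \<delta> where "0 < \<delta>" "\<forall>\<^sub>F j in sequentially. \<forall>z\<in>K. \<delta> \<le> dist (F j z) y"
proof -
  \<comment> \<open>One third each for the convergence at \<open>z\<close>, the oscillation near \<open>z\<close>, and the remaining gap.\<close>
  define h where "h z = dist (f z) y / 3" for z
  have h: "0 < h z" if "z \<in> K" for z
    using y that by (auto simp: h_def)
  obtain r where r: "\<And>z. z \<in> K \<Longrightarrow> 0 < r z"
    "\<And>z j w. z \<in> K \<Longrightarrow> w \<in> K \<Longrightarrow> dist w z < r z \<Longrightarrow> dist (F j w) (F j z) < h z"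
  proof -
    have "\<forall>z\<in>K. \<exists>r>0. \<forall>j. \<forall>w\<in>K. dist w z < r \<longrightarrow> dist (F j w) (F j z) < h z"
      using equi h by simp
    from bchoice[OF this] obtain r where "\<forall>z\<in>K. r z > 0 \<and> (\<forall>j. \<forall>w\<in>K. dist w z < r z \<longrightarrow> dist (F j w) (F j z) < h z)"
      by blast
    then show ?thesis by (intro that[of r]) auto
  qed
  obtain Z where Z: "Z \<subseteq> K" "finite Z" "K \<subseteq> (\<Union>z\<in>Z. ball z (r z))"
    using compactE_image[OF \<open>compact K\<close>, of K "\<lambda>z. ball z (r z)"] r(1) by force
  \<comment> \<open>The element \<open>1\<close> makes the minimum meaningful when \<open>K\<close>, and hence \<open>Z\<close>, is empty.\<close>
  define \<delta> where "\<delta> = Min (insert 1 (h ` Z))"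
  have "0 < \<delta>"
    using Z h by (auto simp: \<delta>_def)
  have "\<forall>\<^sub>F j in sequentially. \<forall>z\<in>Z. dist (F j z) (f z) < h z"
    using Z h lim by (intro eventually_ball_finite) (auto simp: tendsto_iff)
  then have "\<forall>\<^sub>F j in sequentially. \<forall>z\<in>K. \<delta> \<le> dist (F j z) y"
  proof eventually_elim
    case (elim j)
    show ?case
    proof
      fix w assume "w \<in> K"
      then obtain z where z: "z \<in> Z" "dist w z < r z"
        using Z by (auto simp: dist_commute)
      have "dist (f z) y \<le> dist (F j z) (f z) + dist (F j w) (F j z) + dist (F j w) y"
        by metric
      moreover have "dist (F j w) (F j z) < h z" "dist (F j z) (f z) < h z"
        using r(2) z Z \<open>w \<in> K\<close> elim by auto
      moreover have "\<delta> \<le> h z"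
        using z Z by (simp add: \<delta>_def)
      ultimately show "\<delta> \<le> dist (F j w) y"
        unfolding h_def by linarith
    qed
  qed
  with \<open>0 < \<delta>\<close> show ?thesis by (rule that)
qed

text \<open>The values \<open>F j x\<close> enter every ball around \<open>f x\<close>, while the images of \<open>frontier U\<close> stay out of a
  fixed one. This ball meets \<open>F j ` U\<close> and cannot cross its boundary, so it lies inside, together
  with its centre.\<close>

lemma limit_value_eventually_attained:
  fixes F :: "nat \<Rightarrow> 'a::euclidean_space \<Rightarrow> 'a"
  assumes "open U" "bounded U" "x \<in> U"
    and lim: "\<And>z. z \<in> closure U \<Longrightarrow> (\<lambda>j. F j z) \<longlonglongrightarrow> f z"
    and equi: "\<And>z e. z \<in> closure U \<Longrightarrow> 0 < e \<Longrightarrow>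
      \<exists>r>0. \<forall>j. \<forall>w\<in>closure U. dist w z < r \<longrightarrow> dist (F j w) (F j z) < e"
    and inj: "\<And>j. inj_on (F j) U"
    and "f x \<notin> f ` frontier U"
  shows "\<forall>\<^sub>F j in sequentially. f x \<in> F j ` U"
proof -
  have sub: "frontier U \<subseteq> closure U" by (simp add: frontier_def)
  obtain \<delta> where "0 < \<delta>"
    and far: "\<forall>\<^sub>F j in sequentially. \<forall>z\<in>frontier U. \<delta> \<le> dist (F j z) (f x)"
  proof (rule eventually_uniformly_away_from_value[of "frontier U" F f "f x"])
    show "compact (frontier U)"
      using \<open>bounded U\<close> by (simp add: compact_frontier_bounded)
    show "\<exists>r>0. \<forall>j. \<forall>w\<in>frontier U. dist w z < r \<longrightarrow> dist (F j w) (F j z) < e"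
      if "z \<in> frontier U" "0 < e" for z e
      using equi[of z e] that sub by (meson subsetD)
  qed (use assms sub in auto)
  have cont: "continuous_on (closure U) (F j)" for j
    unfolding continuous_on_iff using equi by meson
  have "x \<in> closure U"
    using \<open>x \<in> U\<close> closure_subset by blast
  then have "\<forall>\<^sub>F j in sequentially. dist (F j x) (f x) < \<delta>"
    using lim \<open>0 < \<delta>\<close> by (simp add: tendsto_iff)
  with far show ?thesis
  proof eventually_elim
    case (elim j)
    have "ball (f x) \<delta> \<subseteq> F j ` U"
    proof (rule injective_image_contains_connected[OF \<open>open U\<close> \<open>bounded U\<close> cont inj connected_ball])
      show "ball (f x) \<delta> \<inter> F j ` U \<noteq> {}"
        using elim(2) \<open>x \<in> U\<close> mem_ball[of "F j x" "f x" \<delta>] by (metis dist_commute disjoint_iff imageI)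
      show "ball (f x) \<delta> \<inter> F j ` frontier U = {}"
        using elim(1) by (force simp: dist_commute)
    qed
    then show ?case
      using \<open>0 < \<delta>\<close> by auto
  qed
qed

lemma equi_holder_imp_equicontinuous:
  fixes F :: "nat \<Rightarrow> 'a::real_normed_vector \<Rightarrow> 'b::real_normed_vector"
  assumes "0 < s" "0 \<le> M" "0 < e" "z \<in> S"
    and F: "\<And>j x y. x \<in> S \<Longrightarrow> y \<in> S \<Longrightarrow> norm (F j x - F j y) \<le> M * norm (x - y) powr s"
  shows "\<exists>r>0. \<forall>j. \<forall>w\<in>S. dist w z < r \<longrightarrow> dist (F j w) (F j z) < e"
proof (intro exI conjI allI ballI impI)
  define r where "r = (e / (M + 1)) powr (1 / s)"
  show "0 < r"
    using assms by (simp add: r_def)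
  fix j w assume "w \<in> S" "dist w z < r"
  then have "norm (w - z) powr s \<le> r powr s"
    using \<open>0 < s\<close> by (intro powr_mono2) (auto simp: dist_norm)
  also have "\<dots> = e / (M + 1)"
    using assms by (simp add: r_def powr_powr)
  finally have "M * norm (w - z) powr s \<le> M * (e / (M + 1))"
    using \<open>0 \<le> M\<close> by (rule mult_left_mono)
  also have "\<dots> < e"
    using assms by (simp add: field_simps)
  finally show "dist (F j w) (F j z) < e"
    using F[OF \<open>w \<in> S\<close> \<open>z \<in> S\<close>, of j] by (simp add: dist_norm)
qed

lemma rational_box_neighbourhood:
  fixes x :: "'a::euclidean_space"
  assumes "0 < e"
  obtains U where "open U" "bounded U" "x \<in> U" "closure U \<subseteq> cball x e"
    "frontier U \<subseteq> rational_grid"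
proof -
  obtain a b where ab: "\<forall>i\<in>Basis. a \<bullet> i \<in> \<rat> \<and> b \<bullet> i \<in> \<rat>" "x \<in> box a b" "box a b \<subseteq> ball x e"
    using rational_boxes[OF assms, of x] by blast
  show ?thesis
  proof
    show "closure (box a b) \<subseteq> cball x e"
      using ab(3) ball_subset_cball by (intro closure_minimal) auto
    show "frontier (box a b) \<subseteq> rational_grid"
      using ab(1) by (intro frontier_rational_box_subset_grid) auto
  qed (use ab in \<open>auto simp: open_box\<close>)
qed

theorem corollary1p2:
  fixes \<Omega> :: "(real ^ 'n) set"
    and s :: real
    and f :: "real ^ 'n \<Rightarrow> real ^ 'n"
    and F :: "nat \<Rightarrow> real ^ 'n \<Rightarrow> real ^ 'n"
  assumes "CARD('n) \<ge> 2"
    and "open \<Omega>"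
    and "0 < s" and "s < 1"
    and "s > (real CARD('n) - 1) / real CARD('n)"
    and "f \<in> holder_space s \<Omega>"
    and "\<And>j. F j \<in> holder_space s \<Omega>"
    and "\<And>j. \<exists>g. homeomorphism \<Omega> (F j ` \<Omega>) (F j) g"
    and "(SUP j. holder_norm s \<Omega> (F j)) < \<infinity>"
    and "\<And>x. x \<in> \<Omega> \<Longrightarrow> (\<lambda>j. F j x) \<longlonglongrightarrow> f x"
  shows "\<exists>\<Gamma> :: (real ^ 'n) set.
           hausdorff_dim \<Gamma> \<le> ennreal ((real CARD('n) - 1) / s) \<and>
           (\<forall>y \<in> f ` \<Omega> - \<Gamma>. \<exists>!x. x \<in> \<Omega> \<and> f x = y)"
proof -
  have bounded_holder: "\<exists>M\<ge>0. c = ennreal M" if "c < \<infinity>" for c :: ennreal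
    using that by (cases c) auto
  obtain M where M: "0 \<le> M" "holder_norm s \<Omega> f = ennreal M"
    using bounded_holder[of "holder_norm s \<Omega> f"] \<open>f \<in> holder_space s \<Omega>\<close>
    by (auto simp: holder_space_def)
  have f: "norm (f x - f y) \<le> M * norm (x - y) powr s" if "x \<in> \<Omega>" "y \<in> \<Omega>" for x y
    using M that by (intro holder_norm_bound) auto
  obtain L where L: "0 \<le> L" "(SUP j. holder_norm s \<Omega> (F j)) = ennreal L"
    using bounded_holder[OF assms(9)] by blast
  have "holder_norm s \<Omega> (F j) \<le> ennreal L" for j
    unfolding L(2)[symmetric] by (rule SUP_upper) simp
  then have F: "norm (F j x - F j y) \<le> L * norm (x - y) powr s" if "x \<in> \<Omega>" "y \<in> \<Omega>" for j x y
    using L(1) that by (intro holder_norm_bound) auto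
  have inj: "inj_on (F j) \<Omega>" for j
  proof -
    obtain g where "homeomorphism \<Omega> (F j ` \<Omega>) (F j) g"
      using assms(8) by blast
    then show ?thesis
      by (intro inj_on_inverseI[of _ g]) (rule homeomorphism_apply1)
  qed
  have unique: "x1 = x2"
    if x: "x1 \<in> \<Omega>" "x2 \<in> \<Omega>" "f x1 = y" "f x2 = y" and y: "y \<notin> f ` (\<Omega> \<inter> rational_grid)" for x1 x2 y
  proof (rule ccontr)
    assume "x1 \<noteq> x2"
    \<comment> \<open>The last condition makes the closed balls around \<open>x1\<close> and \<open>x2\<close> disjoint.\<close>
    obtain e where e: "0 < e" "cball x1 e \<subseteq> \<Omega>" "cball x2 e \<subseteq> \<Omega>" "2 * e < dist x1 x2"
    proof -
      obtain e1 e2 where *: "0 < e1" "cball x1 e1 \<subseteq> \<Omega>" "0 < e2" "cball x2 e2 \<subseteq> \<Omega>"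
        using \<open>open \<Omega>\<close> x(1,2) by (meson open_contains_cball)
      define e where "e = min (min e1 e2) (dist x1 x2 / 3)"
      have "0 < dist x1 x2" using \<open>x1 \<noteq> x2\<close> by simp
      then have "0 < e" "e \<le> e1" "e \<le> e2" "2 * e < dist x1 x2"
        using * by (auto simp: e_def min_def)
      moreover have "cball x1 e \<subseteq> \<Omega>" "cball x2 e \<subseteq> \<Omega>"
        using subset_cball[OF \<open>e \<le> e1\<close>, of x1] subset_cball[OF \<open>e \<le> e2\<close>, of x2] * by blast+
      ultimately show ?thesis using that by blast
    qed
    have attained: "\<forall>\<^sub>F j in sequentially. y \<in> F j ` cball x e"
      if "x \<in> \<Omega>" "cball x e \<subseteq> \<Omega>" "f x = y" for x
    proof -
      obtain U where U: "open U" "bounded U" "x \<in> U" "closure U \<subseteq> cball x e"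
          "frontier U \<subseteq> rational_grid"
        using rational_box_neighbourhood[OF \<open>0 < e\<close>] by blast
      have cl: "closure U \<subseteq> \<Omega>" using U that by blast
      then have UO: "U \<subseteq> \<Omega>" using closure_subset by blast
      have "\<forall>\<^sub>F j in sequentially. f x \<in> F j ` U"
      proof (rule limit_value_eventually_attained[OF U(1-3)])
        show "(\<lambda>j. F j z) \<longlonglongrightarrow> f z" if "z \<in> closure U" for z
          using cl that assms(10) by blast
        show "\<exists>r>0. \<forall>j. \<forall>w\<in>closure U. dist w z < r \<longrightarrow> dist (F j w) (F j z) < e'"
          if "z \<in> closure U" "0 < e'" for z e'
        proof (rule equi_holder_imp_equicontinuous[OF \<open>0 < s\<close> L(1) that(2,1)])
          show "norm (F j x - F j y) \<le> L * norm (x - y) powr s"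
            if "x \<in> closure U" "y \<in> closure U" for j x y
            using F cl that by blast
        qed
        show "inj_on (F j) U" for j
          using inj UO by (rule inj_on_subset)
        show "f x \<notin> f ` frontier U"
          using y U(5) cl \<open>f x = y\<close> by (auto simp: frontier_def)
      qed
      then show ?thesis
      proof eventually_elim
        case (elim j)
        then show ?case
          using U(4) closure_subset[of U] \<open>f x = y\<close> by blast
      qed
    qed
    have "\<forall>\<^sub>F j in sequentially. y \<in> F j ` cball x1 e \<and> y \<in> F j ` cball x2 e"
      using attained[of x1] attained[of x2] x e by (simp add: eventually_conj)
    then obtain j where "y \<in> F j ` cball x1 e" "y \<in> F j ` cball x2 e"
      using eventually_happens'[OF sequentially_bot] by blast
    then obtain z1 z2 where z: "z1 \<in> cball x1 e" "z2 \<in> cball x2 e" "F j z1 = F j z2"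
      by force
    then have "z1 = z2"
      using inj[of j] e by (meson inj_onD subsetD)
    then have "dist x1 x2 \<le> 2 * e"
      using z dist_triangle[of x1 x2 z1] by (simp add: dist_commute)
    with e show False by simp
  qed
  show ?thesis
  proof (intro exI conjI ballI)
    show "hausdorff_dim (f ` (\<Omega> \<inter> rational_grid)) \<le> ennreal ((real CARD('n) - 1) / s)"
      using hausdorff_dim_holder_image_rational_grid[OF \<open>0 < s\<close> M(1) f] by simp
    show "\<exists>!x. x \<in> \<Omega> \<and> f x = y" if "y \<in> f ` \<Omega> - f ` (\<Omega> \<inter> rational_grid)" for y
      using that unique by blast
  qed
qed

end
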